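(* Let $G$ be an interval graph and $G_c$ its weighted conflict graph. Then a family $\mathcal{S}=\{S_1,\dots,S_k\}$ of pairwise disjoint cliques of $G$ is a maximum cardinality separated-cluster of $G$ (i.e. $S_1\cup\dots\cup S_k$ is a separated-cluster of maximum size and $S_1,\dots,S_k$ are the vertex sets of the connected components of $G[S_1\cup\dots\cup S_k]$) if and only if $\mathcal{S}\subseteq V(G_c)$ and $\mathcal{S}$ is a maximum weight independent set in $G_c$.
   Context: A separated-cluster of $G$ is a set $S\subseteq V(G)$ with no two vertices at distance exactly $2$ in $G$; then $G[S]$ is a disjoint union of cliques. Fix an interval representation $\{I_v=[l(v),r(v)]\}_{v\in V(G)}$ of $G$. For a maximal clique $C$ and $v,u\in C$, let $C^{lr}(v,u)=\{w\in C: l(w)\ge l(v),\ r(w)\le r(u)\}$; $\hat{\mathcal{C}}$ is the collection of all nonempty such sets over all maximal cliques $C$ and $v,u\in C$. The weighted conflict graph $G_c$ has vertex set $\hat{\mathcal{C}}$, weight $w(K)=|K|$, and distinct $K_i,K_j$ are adjacent iff (a) $K_i\cap K_j\ne\emptyset$, or (b) some $x\in K_i,y\in K_j$ have $xy\in E(G)$, or (c) some $x\in K_i$, $y\in K_j$, $z\in V(G)\setminus(K_i\cup K_j)$ have $x,y\in N_G(z)$. The weight of an independent set is the sum of the weights of its vertices. *)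

theory Defs
  imports "Graph_Theory.Graph_Theory"
begin

text \<open>
  A finite simple undirected graph is an instance of the locale \<^locale>\<open>graph\<close>: a finite
  digraph without loops or parallel arcs whose adjacency relation is symmetric.
\<close>

definition clique :: "('a, 'b) pre_digraph \<Rightarrow> 'a set \<Rightarrow> bool" where
  "clique G C \<longleftrightarrow> C \<subseteq> verts G \<and> (\<forall>u\<in>C. \<forall>v\<in>C. u \<noteq> v \<longrightarrow> u \<rightarrow>\<^bsub>G\<^esub> v)"

definition maximal_clique :: "('a, 'b) pre_digraph \<Rightarrow> 'a set \<Rightarrow> bool" where
  "maximal_clique G C \<longleftrightarrow> clique G C \<and> \<not> (\<exists>D. clique G D \<and> C \<subset> D)"

definition interval_representation ::
    "('a, 'b) pre_digraph \<Rightarrow> ('a \<Rightarrow> real) \<Rightarrow> ('a \<Rightarrow> real) \<Rightarrow> bool" where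
  "interval_representation G l r \<longleftrightarrow>
     (\<forall>v\<in>verts G. l v \<le> r v) \<and>
     (\<forall>u\<in>verts G. \<forall>v\<in>verts G. u \<noteq> v \<longrightarrow>
        (u \<rightarrow>\<^bsub>G\<^esub> v \<longleftrightarrow> {l u..r u} \<inter> {l v..r v} \<noteq> {}))"

text \<open>The usual graph distance: the shortest-path cost when every arc has cost 1
  (\<open>\<infinity>\<close> if there is no path).\<close>

definition distance :: "('a, 'b) pre_digraph \<Rightarrow> 'a \<Rightarrow> 'a \<Rightarrow> ereal" where
  "distance G u v = wf_digraph.\<mu> G (\<lambda>_. 1) u v"

definition separated_cluster :: "('a, 'b) pre_digraph \<Rightarrow> 'a set \<Rightarrow> bool" where
  "separated_cluster G S \<longleftrightarrow> S \<subseteq> verts G \<and> (\<forall>u\<in>S. \<forall>v\<in>S. distance G u v \<noteq> 2)"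

definition maximum_separated_cluster :: "('a, 'b) pre_digraph \<Rightarrow> 'a set \<Rightarrow> bool" where
  "maximum_separated_cluster G S \<longleftrightarrow>
     separated_cluster G S \<and> (\<forall>T. separated_cluster G T \<longrightarrow> card T \<le> card S)"

text \<open>In a symmetric digraph the strongly connected components are the connected components
  of the undirected graph.\<close>

definition maximum_separated_cluster_family ::
    "('a, 'b) pre_digraph \<Rightarrow> 'a set set \<Rightarrow> bool" where
  "maximum_separated_cluster_family G \<S> \<longleftrightarrow>
     maximum_separated_cluster G (\<Union>\<S>) \<and> \<S> = pre_digraph.sccs_verts (G \<restriction> \<Union>\<S>)"

definition C_lr :: "('a \<Rightarrow> real) \<Rightarrow> ('a \<Rightarrow> real) \<Rightarrow> 'a set \<Rightarrow> 'a \<Rightarrow> 'a \<Rightarrow> 'a set" where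
  "C_lr l r C v u = {w \<in> C. l w \<ge> l v \<and> r w \<le> r u}"

definition C_hat ::
    "('a, 'b) pre_digraph \<Rightarrow> ('a \<Rightarrow> real) \<Rightarrow> ('a \<Rightarrow> real) \<Rightarrow> 'a set set" where
  "C_hat G l r =
     {C_lr l r C v u |C v u. maximal_clique G C \<and> v \<in> C \<and> u \<in> C \<and> C_lr l r C v u \<noteq> {}}"

definition conflict :: "('a, 'b) pre_digraph \<Rightarrow> 'a set \<Rightarrow> 'a set \<Rightarrow> bool" where
  "conflict G K L \<longleftrightarrow>
     K \<inter> L \<noteq> {} \<or>
     (\<exists>x\<in>K. \<exists>y\<in>L. x \<rightarrow>\<^bsub>G\<^esub> y) \<or>
     (\<exists>x\<in>K. \<exists>y\<in>L. \<exists>z\<in>verts G - (K \<union> L). z \<rightarrow>\<^bsub>G\<^esub> x \<and> z \<rightarrow>\<^bsub>G\<^esub> y)"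

definition conflict_graph ::
    "('a, 'b) pre_digraph \<Rightarrow> ('a \<Rightarrow> real) \<Rightarrow> ('a \<Rightarrow> real) \<Rightarrow> ('a set, 'a set \<times> 'a set) pre_digraph" where
  "conflict_graph G l r = with_proj
     \<lparr> pverts = C_hat G l r,
       parcs = {(K, L). K \<in> C_hat G l r \<and> L \<in> C_hat G l r \<and> K \<noteq> L \<and> conflict G K L} \<rparr>"

definition conflict_weight :: "'a set \<Rightarrow> nat" where
  "conflict_weight K = card K"

definition independent_set :: "('a, 'b) pre_digraph \<Rightarrow> 'a set \<Rightarrow> bool" where
  "independent_set H T \<longleftrightarrow> T \<subseteq> verts H \<and> (\<forall>x\<in>T. \<forall>y\<in>T. \<not> x \<rightarrow>\<^bsub>H\<^esub> y)"

definition maximum_weight_independent_set ::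
    "('a, 'b) pre_digraph \<Rightarrow> ('a \<Rightarrow> nat) \<Rightarrow> 'a set \<Rightarrow> bool" where
  "maximum_weight_independent_set H w T \<longleftrightarrow>
     independent_set H T \<and> (\<forall>T'. independent_set H T' \<longrightarrow> sum w T' \<le> sum w T)"

end

theory Submission
  imports Defs
begin

text \<open>
  In an independent set of the conflict graph distinct members are disjoint and non-adjacent, and
  vertices of distinct members have no common neighbour; as the members are cliques, their union is a
  separated-cluster with exactly these components, and its size is the weight. Conversely, the
  components of any separated-cluster are pairwise free of conflicts, so only membership in
  \<open>C_hat\<close> needs maximality: for a component \<open>K\<close> inside a maximal clique \<open>C\<close>, let \<open>v\<close>, \<open>u\<close> be the
  vertices of \<open>K\<close> with leftmost left and rightmost right endpoint. As the intervals of \<open>v\<close> and \<open>u\<close>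
  meet, every neighbour of a vertex of \<open>C_lr l r C v u\<close> equals or is adjacent to \<open>v\<close> or \<open>u\<close>. Hence
  enlarging \<open>K\<close> to \<open>C_lr l r C v u\<close> keeps the set a separated-cluster, and maximality forces
  \<open>K = C_lr l r C v u\<close>.
\<close>

unbundle no funcset_syntax \<comment> \<open>its arrow clashes with the adjacency notation\<close>

section \<open>Distance two and separated-clusters in terms of adjacency\<close>

text \<open>With unit costs a walk costs its length, and walks of length 0, 1 and 2 translate into
  equality, adjacency and a common intermediate vertex.\<close>

lemma (in wf_digraph) distance_eq_2_iff:
  "distance G u v = 2 \<longleftrightarrow> u \<noteq> v \<and> \<not> u \<rightarrow> v \<and> (\<exists>z. u \<rightarrow> z \<and> z \<rightarrow> v)"
proof -
  have cost: "awalk_cost (\<lambda>_. 1) p = real (length p)" for p :: "'b list"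
    by (induction p) auto
  have dist: "distance G u v = (INF p\<in>{p. awalk u p v}. ereal (real (length p)))"
    by (simp add: distance_def \<mu>_def cost)
  have dom: "x \<rightarrow> y \<longleftrightarrow> (\<exists>e\<in>arcs G. tail G e = x \<and> head G e = y)" for x y
    by (auto simp: arcs_ends_conv)
  have walk2: "(\<exists>p. awalk u p v \<and> length p = 2) \<longleftrightarrow> (\<exists>z. u \<rightarrow> z \<and> z \<rightarrow> v)"
  proof
    assume "\<exists>p. awalk u p v \<and> length p = 2"
    then show "\<exists>z. u \<rightarrow> z \<and> z \<rightarrow> v"
      by (fastforce simp: numeral_2_eq_2 length_Suc_conv awalk_simps dom)
  next
    assume "\<exists>z. u \<rightarrow> z \<and> z \<rightarrow> v"
    then obtain e e' where "e \<in> arcs G" "tail G e = u" "e' \<in> arcs G" "tail G e' = head G e" "head G e' = v"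
      by (auto simp: dom)
    then have "awalk u [e, e'] v" by (auto simp: awalk_simps)
    then show "\<exists>p. awalk u p v \<and> length p = 2" by (intro exI[of _ "[e, e']"]) simp
  qed
  have walk1: "(\<exists>p. awalk u p v \<and> length p = 1) \<longleftrightarrow> u \<rightarrow> v"
    by (fastforce simp: length_Suc_conv awalk_simps dom intro: exI[of _ "[_]"])
  show ?thesis
  proof
    assume d: "distance G u v = 2"
    have ge: "2 \<le> length p" if "awalk u p v" for p
    proof -
      have "2 \<le> ereal (real (length p))"
        using INF_lower[of p "{p. awalk u p v}" "\<lambda>p. ereal (real (length p))"] that d dist by simp
      then show ?thesis by simp
    qed
    \<comment> \<open>Comparing the infimum strictly with 3 yields an actual walk shorter than 3,
      without showing first that the infimum is attained; \<open>ge\<close> then fixes its length at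
      2.\<close>
    have "(INF p\<in>{p. awalk u p v}. ereal (real (length p))) < 3"
      using d dist by simp
    then obtain p where p: "awalk u p v" "ereal (real (length p)) < 3"
      by (auto simp: INF_less_iff)
    then have "length p = 2" using ge[OF p(1)] by simp
    moreover have "u \<noteq> v" using ge[of "[]"] p(1) by (auto simp: awalk_Nil_iff awalk_hd_in_verts)
    moreover have "\<not> u \<rightarrow> v" using ge walk1 by fastforce
    ultimately show "u \<noteq> v \<and> \<not> u \<rightarrow> v \<and> (\<exists>z. u \<rightarrow> z \<and> z \<rightarrow> v)"
      using walk2 p(1) by blast
  next
    assume a: "u \<noteq> v \<and> \<not> u \<rightarrow> v \<and> (\<exists>z. u \<rightarrow> z \<and> z \<rightarrow> v)"
    obtain p where p: "awalk u p v" "length p = 2" using walk2 a by blast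
    have ge: "2 \<le> length q" if q: "awalk u q v" for q
    proof (rule ccontr)
      assume "\<not> 2 \<le> length q"
      then consider "q = []" | "length q = 1" by (cases q) (auto simp: not_less_eq_eq)
      then show False using q a walk1 by cases (auto simp: awalk_Nil_iff)
    qed
    show "distance G u v = 2"
      unfolding dist
    proof (rule antisym)
      show "(INF p\<in>{p. awalk u p v}. ereal (real (length p))) \<le> 2"
        using INF_lower[of p "{p. awalk u p v}" "\<lambda>p. ereal (real (length p))"] p by simp
      show "2 \<le> (INF p\<in>{p. awalk u p v}. ereal (real (length p)))"
        by (rule INF_greatest) (use ge in simp)
    qed
  qed
qed

text \<open>Recasts the metric condition as a shortcut rule: a two-step walk with both ends in
  \<open>S\<close>, through any \<open>z\<close> inside or outside \<open>S\<close>, collapses to at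
  most one step.\<close>

lemma (in wf_digraph) separated_cluster_iff:
  "separated_cluster G S \<longleftrightarrow>
     S \<subseteq> verts G \<and> (\<forall>u\<in>S. \<forall>v\<in>S. \<forall>z. u \<rightarrow> z \<longrightarrow> z \<rightarrow> v \<longrightarrow> u = v \<or> u \<rightarrow> v)"
  unfolding separated_cluster_def distance_eq_2_iff by blast

section \<open>Connected components of a separated-cluster\<close>

text \<open>Induction along a path: each further step makes a two-step walk from \<open>u\<close>,
  which the shortcut rule shortens again.\<close>

lemma (in wf_digraph) reachable_separated_cluster_iff:
  assumes S: "separated_cluster G S"
  shows "u \<rightarrow>\<^sup>*\<^bsub>G \<restriction> S\<^esub> v \<longleftrightarrow> u \<in> S \<and> v \<in> S \<and> (u = v \<or> u \<rightarrow> v)"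
proof
  interpret H: wf_digraph "G \<restriction> S" by (rule wellformed_induce_subgraph)
  have dom: "x \<rightarrow>\<^bsub>G \<restriction> S\<^esub> y \<longleftrightarrow> x \<in> S \<and> y \<in> S \<and> x \<rightarrow> y" for x y
    by (auto simp: arcs_ends_conv)
  assume "u \<rightarrow>\<^sup>*\<^bsub>G \<restriction> S\<^esub> v"
  then show "u \<in> S \<and> v \<in> S \<and> (u = v \<or> u \<rightarrow> v)"
  proof (induction rule: H.reachable_induct)
    case base
    then show ?case by simp
  next
    case (step x y)
    then show ?case using S unfolding separated_cluster_iff dom by blast
  qed
next
  interpret H: wf_digraph "G \<restriction> S" by (rule wellformed_induce_subgraph)
  assume "u \<in> S \<and> v \<in> S \<and> (u = v \<or> u \<rightarrow> v)"
  then consider "u = v" "u \<in> S" | "u \<rightarrow>\<^bsub>G \<restriction> S\<^esub> v"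
    by (auto simp: arcs_ends_conv)
  then show "u \<rightarrow>\<^sup>*\<^bsub>G \<restriction> S\<^esub> v"
    by cases auto
qed

lemma (in wf_digraph) Union_sccs_verts_induce_subgraph:
  "\<Union> (pre_digraph.sccs_verts (G \<restriction> S)) = S"
proof -
  interpret H: wf_digraph "G \<restriction> S" by (rule wellformed_induce_subgraph)
  show ?thesis
    using H.sccs_verts_subsets H.scc_of_in_sccs_verts H.in_scc_of_self by fastforce
qed

lemma (in sym_digraph) dominates_sym: "u \<rightarrow> v \<Longrightarrow> v \<rightarrow> u"
  using sym_arcs by (auto simp: symmetric_def dest: symD)

text \<open>Since reachability within \<open>S\<close> is equality or adjacency, and adjacency is
  symmetric, mutual reachability makes \<open>K\<close> a clique, and the maximality of a strong
  component becomes closure under neighbours in \<open>S\<close>.\<close>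

lemma (in graph) sccs_verts_separated_cluster_iff:
  assumes S: "separated_cluster G S"
  shows "K \<in> pre_digraph.sccs_verts (G \<restriction> S) \<longleftrightarrow>
    K \<noteq> {} \<and> K \<subseteq> S \<and> clique G K \<and> (\<forall>u\<in>K. \<forall>v\<in>S. u \<rightarrow> v \<longrightarrow> v \<in> K)"
proof -
  have sub: "S \<subseteq> verts G" using S by (simp add: separated_cluster_def)
  show ?thesis
    unfolding pre_digraph.sccs_verts_def mem_Collect_eq reachable_separated_cluster_iff[OF S]
      clique_def
  proof (intro iffI conjI; (elim conjE)?)
    assume "\<forall>u\<in>K. \<forall>v\<in>K. u \<in> S \<and> v \<in> S \<and> (u = v \<or> u \<rightarrow> v)"
    then show "K \<subseteq> S" "K \<subseteq> verts G" "\<forall>u\<in>K. \<forall>v\<in>K. u \<noteq> v \<longrightarrow> u \<rightarrow> v"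
      using sub by auto
  next
    assume "\<forall>u\<in>K. \<forall>v\<in>K. u \<in> S \<and> v \<in> S \<and> (u = v \<or> u \<rightarrow> v)"
      and "\<forall>u\<in>K. \<forall>v. v \<notin> K \<longrightarrow> \<not> (u \<in> S \<and> v \<in> S \<and> (u = v \<or> u \<rightarrow> v)) \<or>
        \<not> (v \<in> S \<and> u \<in> S \<and> (v = u \<or> v \<rightarrow> u))"
    then show "\<forall>u\<in>K. \<forall>v\<in>S. u \<rightarrow> v \<longrightarrow> v \<in> K"
      by (meson dominates_sym)
  qed auto
qed

text \<open>By \<open>nb\<close>, a two-step walk from \<open>K\<close> to \<open>S\<close> can be
  rerouted to start in \<open>D\<close> or one step later, so it ends in \<open>D\<close>. New
  vertices thus create no distance two to the rest of \<open>S\<close>.\<close>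

lemma (in graph) separated_cluster_enlarge_component:
  assumes S: "separated_cluster G S"
    and D: "D \<in> pre_digraph.sccs_verts (G \<restriction> S)"
    and K: "clique G K" "D \<subseteq> K"
    and nb: "\<And>w z. w \<in> K \<Longrightarrow> w \<rightarrow> z \<Longrightarrow> \<exists>a\<in>D. z = a \<or> a \<rightarrow> z"
  shows "separated_cluster G (S \<union> K)"
proof -
  note D' = D[unfolded sccs_verts_separated_cluster_iff[OF S]]
  note S' = S[unfolded separated_cluster_iff]
  have in_K: "y \<in> K" if *: "w \<in> K" "y \<in> S" "w \<rightarrow> z" "z \<rightarrow> y" for w y z
  proof -
    obtain a where a: "a \<in> D" "z = a \<or> a \<rightarrow> z" using nb * by blast
    then have "a = y \<or> a \<rightarrow> y" using S' D' * by blast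
    then have "y \<in> D" using a D' * by blast
    then show ?thesis using K by blast
  qed
  show ?thesis
    unfolding separated_cluster_iff
  proof (intro conjI ballI allI impI)
    show "S \<union> K \<subseteq> verts G" using S' K by (auto simp: clique_def)
    fix x y z assume *: "x \<in> S \<union> K" "y \<in> S \<union> K" "x \<rightarrow> z" "z \<rightarrow> y"
    \<comment> \<open>In a mixed case, \<open>in_K\<close> applied to the walk or to its reverse
      puts both ends into the clique \<open>K\<close>.\<close>
    then consider "x \<in> S" "y \<in> S" | "x \<in> K" "y \<in> K"
      using in_K dominates_sym by blast
    then show "x = y \<or> x \<rightarrow> y"
      using S' K * by cases (auto simp: clique_def)
  qed
qed

section \<open>Components of a maximum separated-cluster as members of \<open>C_hat\<close>\<close>

lemma (in graph) clique_extends_to_maximal_clique: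
  assumes "clique G K"
  obtains C where "maximal_clique G C" "K \<subseteq> C"
proof -
  have "finite {C. clique G C \<and> K \<subseteq> C}"
    by (rule finite_subset[of _ "Pow (verts G)"]) (auto simp: clique_def)
  moreover have "K \<in> {C. clique G C \<and> K \<subseteq> C}" using assms by simp
  ultimately obtain C where C: "clique G C" "K \<subseteq> C"
    and max: "\<forall>D\<in>{C. clique G C \<and> K \<subseteq> C}. C \<subseteq> D \<longrightarrow> C = D"
    using finite_has_maximal[of "{C. clique G C \<and> K \<subseteq> C}"] by auto
  have "maximal_clique G C"
    unfolding maximal_clique_def using C max by auto
  then show thesis using that C by blast
qed

lemma (in graph) maximum_separated_cluster_components_in_C_hat:
  assumes rep: "interval_representation G l r"
    and S: "maximum_separated_cluster G S"
    and D: "D \<in> pre_digraph.sccs_verts (G \<restriction> S)"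
  shows "D \<in> C_hat G l r"
proof -
  have sep: "separated_cluster G S" using S by (simp add: maximum_separated_cluster_def)
  have D': "D \<noteq> {}" "D \<subseteq> S" "clique G D" "\<And>u v. u \<in> D \<Longrightarrow> v \<in> S \<Longrightarrow> u \<rightarrow> v \<Longrightarrow> v \<in> D"
    using D sccs_verts_separated_cluster_iff[OF sep] by auto
  have DV: "D \<subseteq> verts G" using D'(3) by (simp add: clique_def)
  then have fD: "finite D" using finite_subset[OF _ finite_verts] by blast
  obtain C where C: "maximal_clique G C" "D \<subseteq> C"
    using clique_extends_to_maximal_clique[OF D'(3)] by blast
  have CV: "C \<subseteq> verts G" and Cc: "clique G C"
    using C(1) by (auto simp: maximal_clique_def clique_def)
  obtain v where v: "v \<in> D" "\<And>w. w \<in> D \<Longrightarrow> l v \<le> l w"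
    using ex_is_arg_min_if_finite[OF fD D'(1), of l] by (force simp: is_arg_min_linorder)
  obtain u where u: "u \<in> D" "\<And>w. w \<in> D \<Longrightarrow> r w \<le> r u"
    using ex_is_arg_min_if_finite[OF fD D'(1), of "\<lambda>w. - r w"] by (force simp: is_arg_min_linorder)
  define K where "K = C_lr l r C v u"
  have DK: "D \<subseteq> K" using C(2) v u by (auto simp: K_def C_lr_def)
  have KC: "K \<subseteq> C" by (auto simp: K_def C_lr_def)
  have Kc: "clique G K" using KC Cc by (auto simp: clique_def)
  have adj: "x \<rightarrow> y \<longleftrightarrow> l x \<le> r y \<and> l y \<le> r x" if "x \<in> verts G" "y \<in> verts G" "x \<noteq> y" for x y
  proof -
    have "x \<rightarrow> y \<longleftrightarrow> {l x..r x} \<inter> {l y..r y} \<noteq> {}" and "l x \<le> r x" "l y \<le> r y"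
      using rep that by (auto simp: interval_representation_def)
    then show ?thesis by auto
  qed
  have le: "l x \<le> r x" if "x \<in> verts G" for x
    using rep that by (simp add: interval_representation_def)
  have "\<exists>a\<in>D. z = a \<or> a \<rightarrow> z" if w: "w \<in> K" and wz: "w \<rightarrow> z" for w z
  proof (rule ccontr)
    assume "\<not> ?thesis"
    then have n: "z \<noteq> v" "z \<noteq> u" "\<not> v \<rightarrow> z" "\<not> u \<rightarrow> z" using v u by auto
    have V: "w \<in> verts G" "z \<in> verts G" "v \<in> verts G" "u \<in> verts G"
      using wz adj_in_verts v(1) u(1) DV by auto
    have "w \<noteq> z" using wz no_loops by (auto simp: arcs_ends_conv)
    then have "l w \<le> r z" "l z \<le> r w" using wz adj V by auto
    moreover have "l v \<le> l w" "r w \<le> r u" using w by (auto simp: K_def C_lr_def)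
    moreover have "l u \<le> r v"
    proof (cases "u = v")
      case False
      then have "u \<rightarrow> v" using D'(3) u v by (auto simp: clique_def)
      then show ?thesis using adj V False by auto
    qed (use le V in auto)
    moreover have "l z \<le> r z" using le V by blast
    moreover have "\<not> (l v \<le> r z \<and> l z \<le> r v)" "\<not> (l u \<le> r z \<and> l z \<le> r u)"
      using n adj V by auto
    \<comment> \<open>Meeting the interval of \<open>w\<close>, that of \<open>z\<close> lies
      neither left of \<open>v\<close> nor right of \<open>u\<close>. Missing both, it would lie
      right of \<open>v\<close> and left of \<open>u\<close>, in a gap that
      \<open>l u \<le> r v\<close> excludes.\<close>
    ultimately show False by linarith
  qed
  then have SK: "separated_cluster G (S \<union> K)"
    using separated_cluster_enlarge_component[OF sep D Kc DK] by blast
  then have "card (S \<union> K) \<le> card S" using S by (simp add: maximum_separated_cluster_def)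
  moreover have "finite (S \<union> K)"
    using SK finite_subset[OF _ finite_verts] by (auto simp: separated_cluster_def)
  ultimately have "K \<subseteq> S" by (metis Un_upper1 Un_upper2 card_seteq)
  \<comment> \<open>All of \<open>K\<close> now lies in \<open>S\<close>, so the clique
    \<open>K\<close> cannot leave the component of its vertex \<open>v\<close>.\<close>
  have "K \<subseteq> D"
  proof
    fix x assume "x \<in> K"
    then have "x = v \<or> v \<rightarrow> x" using Kc DK v(1) by (auto simp: clique_def)
    then show "x \<in> D" using D'(4) v(1) \<open>x \<in> K\<close> \<open>K \<subseteq> S\<close> by blast
  qed
  then have "D = C_lr l r C v u" using DK by (simp add: K_def)
  then show ?thesis
    unfolding C_hat_def using C v(1) u(1) D'(1) by blast
qed

section \<open>Independent sets of the conflict graph\<close>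

lemma independent_set_conflict_graph_iff:
  "independent_set (conflict_graph G l r) T \<longleftrightarrow>
     T \<subseteq> C_hat G l r \<and> (\<forall>K\<in>T. \<forall>L\<in>T. K \<noteq> L \<longrightarrow> \<not> conflict G K L)"
  by (auto simp: independent_set_def conflict_graph_def arcs_ends_def arc_to_ends_def
      with_proj_simps)

lemma C_hat_clique:
  assumes "K \<in> C_hat G l r"
  shows "clique G K" "K \<noteq> {}"
  using assms by (auto simp: C_hat_def C_lr_def maximal_clique_def clique_def)

lemma (in graph) separated_cluster_Union_independent_set:
  assumes T: "independent_set (conflict_graph G l r) T"
  shows "separated_cluster G (\<Union>T)"
    and "pre_digraph.sccs_verts (G \<restriction> \<Union>T) = T"
    and "sum conflict_weight T = card (\<Union>T)"
proof -
  have cl: "clique G K" "K \<noteq> {}" if "K \<in> T" for K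
    using T that C_hat_clique[of K G l r] by (auto simp: independent_set_conflict_graph_iff)
  have nc: "\<not> conflict G K L" if "K \<in> T" "L \<in> T" "K \<noteq> L" for K L
    using T that by (simp add: independent_set_conflict_graph_iff)
  have TV: "\<Union>T \<subseteq> verts G" using cl by (auto simp: clique_def)
  have same: "L = K" if "K \<in> T" "L \<in> T" "x \<in> K" "y \<in> L" "x = y \<or> x \<rightarrow> y" for K L x y
    using nc[of K L] that unfolding conflict_def by blast
  show sep: "separated_cluster G (\<Union>T)"
    unfolding separated_cluster_iff
  proof (intro conjI ballI allI impI TV)
    fix x y z assume *: "x \<in> \<Union>T" "y \<in> \<Union>T" "x \<rightarrow> z" "z \<rightarrow> y"
    then obtain K L where KL: "K \<in> T" "x \<in> K" "L \<in> T" "y \<in> L" by blast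
    have "K = L"
    proof (rule ccontr)
      assume "K \<noteq> L"
      then have n: "\<not> conflict G K L" using nc KL by blast
      \<comment> \<open>Outside both members \<open>z\<close> would be a forbidden common neighbour;
        inside \<open>K\<close> the arc to \<open>y\<close>, and inside \<open>L\<close> the arc
        from \<open>x\<close>, would join the two members.\<close>
      then have "z \<notin> verts G - (K \<union> L)" "z \<notin> K" "z \<notin> L"
        using * KL dominates_sym unfolding conflict_def by blast+
      then show False using * adj_in_verts by blast
    qed
    then show "x = y \<or> x \<rightarrow> y" using cl[OF KL(1)] KL by (auto simp: clique_def)
  qed
  show "pre_digraph.sccs_verts (G \<restriction> \<Union>T) = T"
  proof (intro set_eqI iffI)
    fix K assume "K \<in> T"
    then show "K \<in> pre_digraph.sccs_verts (G \<restriction> \<Union>T)"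
      unfolding sccs_verts_separated_cluster_iff[OF sep] using cl same by blast
  next
    fix K assume "K \<in> pre_digraph.sccs_verts (G \<restriction> \<Union>T)"
    then have K: "K \<noteq> {}" "K \<subseteq> \<Union>T" "clique G K" "\<And>u v. u \<in> K \<Longrightarrow> v \<in> \<Union>T \<Longrightarrow> u \<rightarrow> v \<Longrightarrow> v \<in> K"
      unfolding sccs_verts_separated_cluster_iff[OF sep] by auto
    \<comment> \<open>A component meets some member \<open>L\<close> at \<open>x\<close>. Both are
      cliques closed under neighbours in the union, so they coincide.\<close>
    then obtain x L where x: "x \<in> K" "x \<in> L" "L \<in> T" by blast
    have "K \<subseteq> L"
    proof
      fix y assume "y \<in> K"
      moreover from this obtain M where "M \<in> T" "y \<in> M" using K by blast
      moreover have "x = y \<or> x \<rightarrow> y" using K(3) x \<open>y \<in> K\<close> by (auto simp: clique_def)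
      ultimately show "y \<in> L" using same x by blast
    qed
    moreover have "L \<subseteq> K"
    proof
      fix y assume "y \<in> L"
      then have "x = y \<or> x \<rightarrow> y" using cl(1) x by (auto simp: clique_def)
      then show "y \<in> K" using K(4) x \<open>y \<in> L\<close> by blast
    qed
    ultimately show "K \<in> T" using x by simp
  qed
  have "pairwise disjnt T"
    using nc by (auto simp: pairwise_def disjnt_def conflict_def)
  then have "card (\<Union>T) = sum card T"
    by (rule card_Union_disjoint) (use TV finite_subset[OF _ finite_verts] in blast)
  then show "sum conflict_weight T = card (\<Union>T)"
    by (simp add: conflict_weight_def[abs_def])
qed

lemma (in graph) independent_set_maximum_separated_cluster_components:
  assumes rep: "interval_representation G l r"
    and S: "maximum_separated_cluster G S"
  shows "independent_set (conflict_graph G l r) (pre_digraph.sccs_verts (G \<restriction> S))"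
  unfolding independent_set_conflict_graph_iff
proof (intro conjI ballI impI)
  show "pre_digraph.sccs_verts (G \<restriction> S) \<subseteq> C_hat G l r"
    using maximum_separated_cluster_components_in_C_hat[OF rep S] by blast
  have sep: "separated_cluster G S" using S by (simp add: maximum_separated_cluster_def)
  note iff = sccs_verts_separated_cluster_iff[OF sep]
  fix K L assume KL: "K \<in> pre_digraph.sccs_verts (G \<restriction> S)" "L \<in> pre_digraph.sccs_verts (G \<restriction> S)"
    and ne: "K \<noteq> L"
  have disj: "K \<inter> L = {}"
    using wf_digraph.sccs_verts_disjoint[OF wellformed_induce_subgraph KL ne] .
  have noadj: "\<not> x \<rightarrow> y" if "x \<in> K" "y \<in> L" for x y
    using KL that disj unfolding iff by blast
  \<comment> \<open>A common neighbour, wherever it lies, gives a two-step walk from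
    \<open>x\<close> to \<open>y\<close>, which the shortcut rule forbids across components.\<close>
  have "\<not> (z \<rightarrow> x \<and> z \<rightarrow> y)" if *: "x \<in> K" "y \<in> L" for x y z
  proof
    assume "z \<rightarrow> x \<and> z \<rightarrow> y"
    then have z: "x \<rightarrow> z" "z \<rightarrow> y" by (auto intro: dominates_sym)
    have "x \<in> S" "y \<in> S" using KL * unfolding iff by auto
    then have "x = y \<or> x \<rightarrow> y"
      using sep z unfolding separated_cluster_iff by blast
    then show False using disj noadj * by blast
  qed
  then show "\<not> conflict G K L"
    unfolding conflict_def using disj noadj by blast
qed

section \<open>Comparison of the two maxima\<close>

text \<open>Sizes are bounded by the number of vertices, and the empty set is a
  separated-cluster.\<close>

lemma (in fin_digraph) maximum_separated_cluster_exists: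
  "\<exists>S. maximum_separated_cluster G S"
proof -
  have "card T < Suc (card (verts G))" if "separated_cluster G T" for T
    using that by (simp add: separated_cluster_def card_mono less_Suc_eq_le)
  moreover have "separated_cluster G {}" by (simp add: separated_cluster_def)
  ultimately show ?thesis
    using ex_has_greatest_nat[of "separated_cluster G" "{}" card "Suc (card (verts G))"]
    by (auto simp: maximum_separated_cluster_def intro: less_imp_le)
qed

theorem theorem13:
  fixes G :: "('a, 'b) pre_digraph"
    and l r :: "'a \<Rightarrow> real"
    and \<S> :: "'a set set"
  assumes "graph G"
    and "interval_representation G l r"
    and "\<forall>S\<in>\<S>. clique G S"
    and "pairwise disjnt \<S>"
  shows "maximum_separated_cluster_family G \<S> \<longleftrightarrow>
    \<S> \<subseteq> verts (conflict_graph G l r) \<and>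
    maximum_weight_independent_set (conflict_graph G l r) conflict_weight \<S>"
proof -
  interpret graph G by fact
  note indep = independent_set_maximum_separated_cluster_components[OF assms(2)]
  note cluster = separated_cluster_Union_independent_set[where l = l and r = r]
  show ?thesis
  proof
    assume "maximum_separated_cluster_family G \<S>"
    then have max: "maximum_separated_cluster G (\<Union>\<S>)"
      and comp: "\<S> = pre_digraph.sccs_verts (G \<restriction> \<Union>\<S>)"
      by (auto simp: maximum_separated_cluster_family_def)
    have ind: "independent_set (conflict_graph G l r) \<S>"
      using indep[OF max] comp by simp
    have "sum conflict_weight T \<le> sum conflict_weight \<S>"
      if "independent_set (conflict_graph G l r) T" for T
      using cluster(1,3)[OF that] cluster(3)[OF ind] max
      by (simp add: maximum_separated_cluster_def)
    then show "\<S> \<subseteq> verts (conflict_graph G l r) \<and>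
        maximum_weight_independent_set (conflict_graph G l r) conflict_weight \<S>"
      using ind by (simp add: maximum_weight_independent_set_def independent_set_def)
  next
    assume "\<S> \<subseteq> verts (conflict_graph G l r) \<and>
        maximum_weight_independent_set (conflict_graph G l r) conflict_weight \<S>"
    then have ind: "independent_set (conflict_graph G l r) \<S>"
      and max: "\<And>T. independent_set (conflict_graph G l r) T \<Longrightarrow>
        sum conflict_weight T \<le> sum conflict_weight \<S>"
      by (auto simp: maximum_weight_independent_set_def)
    \<comment> \<open>\<open>M\<close> is the benchmark: its components form an independent set of
      weight \<open>card M\<close>, so the maximum weight, which is the size of
      \<open>\<Union>\<S>\<close>, is at least \<open>card M\<close>.\<close>
    obtain M where M: "maximum_separated_cluster G M"
      using maximum_separated_cluster_exists by blast
    have "card M = sum conflict_weight (pre_digraph.sccs_verts (G \<restriction> M))"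
      using cluster(3)[OF indep[OF M]] by (simp add: Union_sccs_verts_induce_subgraph)
    also have "\<dots> \<le> card (\<Union>\<S>)"
      using max[OF indep[OF M]] cluster(3)[OF ind] by simp
    finally have "maximum_separated_cluster G (\<Union>\<S>)"
      using M cluster(1)[OF ind] by (auto simp: maximum_separated_cluster_def intro: order_trans)
    then show "maximum_separated_cluster_family G \<S>"
      using cluster(2)[OF ind] by (simp add: maximum_separated_cluster_family_def)
  qed
qed

end
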